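(* Let $A$ be the superalgebra of (integrable) functions on the supercircle $S^{1\mid 1}$, i.e. the elements of $A$ are $a(x,\theta)=a^0(x)+a^1(x)\theta$, where $a^0,a^1:[0,1]\to\mathbb{R}$ are (integrable) functions such that $a^i(0)=a^i(1)$, $i=0,1$, and $\theta$ is a Grassmann variable, $\theta^2=0$. Let $\Lambda$ be the integral on $A$ relative to the free right twisted multi-derivation $\partial=(\partial_x,\partial_\theta)$, $\sigma=\begin{pmatrix}\sigma_{xx}&0\\0&\sigma_{\theta\theta}\end{pmatrix}$, $\bar\sigma=\hat\sigma=\sigma$, where $$\partial_x a(x,\theta)=\frac{da^0(x)}{dx}+\frac{da^1(x)}{dx}\theta,\quad \partial_\theta a(x,\theta)=a^1(x),\quad \sigma_{xx}(a(x,\theta))=a(x,\theta),\quad \sigma_{\theta\theta}(a(x,\theta))=a(x,-\theta).$$ Then, for all $a(x,\theta)=a^0(x)+a^1(x)\theta$ in $A$, $$\Lambda(a)=\int_0^1a^1(x)\,dx,$$ i.e. $\Lambda$ is the Berezin integral on the supercircle $S^{1\mid 1}$.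
   Context: The base field is $\mathbb{R}$. In $A$ the variable $\theta$ commutes with functions of $x$, so $(a^0+a^1\theta)(b^0+b^1\theta)=a^0b^0+(a^0b^1+a^1b^0)\theta$. The indices take the two values $x,\theta$. The functions in $A$ are understood to be such that $\partial_x$ is defined as a map $A\to A$. A right twisted multi-derivation $(\partial,\sigma)$ on $A$ consists of linear maps $\partial:A\to A^2$ and $\sigma:A\to M_2(A)$ with $\partial_i(ab)=\sum_j\partial_j(a)\sigma_{ji}(b)+a\partial_i(b)$. It is free, with algebra map $\bar\sigma$ and linear map $\hat\sigma$ from $A$ to $M_2(A)$, when $\sigma$ is a (unital) algebra map and, for all $i,j$, $\sum_k\bar\sigma_{ik}\circ\sigma_{jk}=\sum_k\sigma_{ki}\circ\bar\sigma_{kj}=\sum_k\hat\sigma_{ik}\circ\bar\sigma_{jk}=\sum_k\bar\sigma_{ki}\circ\hat\sigma_{kj}=\delta_{ij}\,\mathrm{id}_A$. The associated first order differential calculus $\Omega^1(A)$ is the free left $A$-module with basis $dx,d\theta$, right action determined by $dx\cdot a=\sigma_{xx}(a)\,dx$, $d\theta\cdot a=\sigma_{\theta\theta}(a)\,d\theta$, and differential $da=\partial_x(a)\,dx+\partial_\theta(a)\,d\theta$. With $\mathrm{Hom}_A(\Omega^1(A),A)$ the space of right $A$-module maps, put $$\nabla:\mathrm{Hom}_A(\Omega^1(A),A)\to A,\qquad \nabla(f)=\partial_x^\sigma(f(dx))+\partial_\theta^\sigma(f(d\theta)),$$ where $\partial_i^\sigma=\sum_{j,k}\bar\sigma_{kj}\circ\partial_j\circ\hat\sigma_{ki}$,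 i.e. here $\partial_x^\sigma=\sigma_{xx}\circ\partial_x\circ\sigma_{xx}$ and $\partial_\theta^\sigma=\sigma_{\theta\theta}\circ\partial_\theta\circ\sigma_{\theta\theta}$. The integral on $A$ relative to these data is the cokernel map $\Lambda:A\to\mathrm{coker}\,\nabla=A/\mathrm{im}\,\nabla$. The formula for $\Lambda$ is understood under an identification of $\mathrm{coker}\,\nabla$ with $\mathbb{R}$. *)

theory Defs
  imports "HOL-Analysis.Analysis"
begin

section \<open>Twisted multi-derivations and their integrals\<close>

text \<open>
  An algebra over the reals is a type of class \<open>real_algebra_1\<close>, not assumed commutative.
  The entries of \<open>D : A \<rightarrow> A\<^sup>n\<close> and \<open>\<sigma> : A \<rightarrow> M\<^sub>n(A)\<close> are \<open>D\<^sub>i(a) = D a $ i\<close> and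
  \<open>\<sigma>\<^sub>i\<^sub>j(a) = \<sigma> a $ i $ j\<close>.
\<close>

definition algebra_map :: "('a::real_algebra_1 \<Rightarrow> 'a^'n::finite^'n) \<Rightarrow> bool" where
  "algebra_map \<sigma> \<longleftrightarrow> linear \<sigma> \<and> \<sigma> 1 = mat 1 \<and> (\<forall>a b. \<sigma> (a * b) = \<sigma> a ** \<sigma> b)"

definition right_twisted_multi_derivation ::
    "('a::real_algebra_1 \<Rightarrow> 'a^'n::finite) \<Rightarrow> ('a \<Rightarrow> 'a^'n^'n) \<Rightarrow> bool" where
  "right_twisted_multi_derivation D \<sigma> \<longleftrightarrow>
     linear D \<and> linear \<sigma> \<and>
     (\<forall>a b i. D (a * b) $ i = (\<Sum>j\<in>UNIV. D a $ j * \<sigma> b $ j $ i) + a * D b $ i)"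

definition free_right_twisted_multi_derivation ::
    "('a::real_algebra_1 \<Rightarrow> 'a^'n::finite) \<Rightarrow> ('a \<Rightarrow> 'a^'n^'n) \<Rightarrow>
     ('a \<Rightarrow> 'a^'n^'n) \<Rightarrow> ('a \<Rightarrow> 'a^'n^'n) \<Rightarrow> bool" where
  "free_right_twisted_multi_derivation D \<sigma> \<sigma>bar \<sigma>hat \<longleftrightarrow>
     right_twisted_multi_derivation D \<sigma> \<and>
     algebra_map \<sigma> \<and> algebra_map \<sigma>bar \<and> linear \<sigma>hat \<and>
     (\<forall>i j a.
        (\<Sum>k\<in>UNIV. \<sigma>bar (\<sigma> a $ j $ k) $ i $ k) = (if i = j then a else 0) \<and>
        (\<Sum>k\<in>UNIV. \<sigma> (\<sigma>bar a $ k $ j) $ k $ i) = (if i = j then a else 0) \<and>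
        (\<Sum>k\<in>UNIV. \<sigma>hat (\<sigma>bar a $ j $ k) $ i $ k) = (if i = j then a else 0) \<and>
        (\<Sum>k\<in>UNIV. \<sigma>bar (\<sigma>hat a $ k $ j) $ k $ i) = (if i = j then a else 0))"

text \<open>
  The free left module \<open>\<Omega>\<^sup>1(A)\<close> with basis \<open>\<omega>\<^sub>i\<close> is the type \<open>'a^'n\<close>: the vector \<open>w\<close> stands for
  \<open>\<Sum>\<^sub>i w\<^sub>i \<omega>\<^sub>i\<close>, so that \<open>\<omega>\<^sub>i = axis i 1\<close> and the differential \<open>a \<mapsto> \<Sum>\<^sub>i D\<^sub>i(a) \<omega>\<^sub>i\<close> is \<open>D\<close> itself.
  The right action below is the one with \<open>\<omega>\<^sub>i \<cdot> a = \<Sum>\<^sub>j \<sigma>\<^sub>i\<^sub>j(a) \<omega>\<^sub>j\<close>.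
\<close>

definition form_right_act ::
    "('a::real_algebra_1 \<Rightarrow> 'a^'n::finite^'n) \<Rightarrow> 'a^'n \<Rightarrow> 'a \<Rightarrow> 'a^'n" where
  "form_right_act \<sigma> w a = (\<chi> j. \<Sum>i\<in>UNIV. w $ i * \<sigma> a $ i $ j)"

definition form_hom ::
    "('a::real_algebra_1 \<Rightarrow> 'a^'n::finite^'n) \<Rightarrow> ('a^'n \<Rightarrow> 'a) set" where
  "form_hom \<sigma> =
     {f. (\<forall>v w. f (v + w) = f v + f w) \<and> (\<forall>w a. f (form_right_act \<sigma> w a) = f w * a)}"

definition partial_sigma ::
    "('a::real_algebra_1 \<Rightarrow> 'a^'n::finite) \<Rightarrow> ('a \<Rightarrow> 'a^'n^'n) \<Rightarrow> ('a \<Rightarrow> 'a^'n^'n) \<Rightarrow>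
     'n \<Rightarrow> 'a \<Rightarrow> 'a" where
  "partial_sigma D \<sigma>bar \<sigma>hat i a =
     (\<Sum>j\<in>UNIV. \<Sum>k\<in>UNIV. \<sigma>bar (D (\<sigma>hat a $ k $ i) $ j) $ k $ j)"

definition nabla ::
    "('a::real_algebra_1 \<Rightarrow> 'a^'n::finite) \<Rightarrow> ('a \<Rightarrow> 'a^'n^'n) \<Rightarrow> ('a \<Rightarrow> 'a^'n^'n) \<Rightarrow>
     ('a^'n \<Rightarrow> 'a) \<Rightarrow> 'a" where
  "nabla D \<sigma>bar \<sigma>hat f = (\<Sum>i\<in>UNIV. partial_sigma D \<sigma>bar \<sigma>hat i (f (axis i 1)))"

definition nabla_rel ::
    "('a::real_algebra_1 \<Rightarrow> 'a^'n::finite) \<Rightarrow> ('a \<Rightarrow> 'a^'n^'n) \<Rightarrow>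
     ('a \<Rightarrow> 'a^'n^'n) \<Rightarrow> ('a \<Rightarrow> 'a^'n^'n) \<Rightarrow> 'a rel" where
  "nabla_rel D \<sigma> \<sigma>bar \<sigma>hat = {(a, b). b - a \<in> nabla D \<sigma>bar \<sigma>hat ` form_hom \<sigma>}"

definition coker_nabla ::
    "('a::real_algebra_1 \<Rightarrow> 'a^'n::finite) \<Rightarrow> ('a \<Rightarrow> 'a^'n^'n) \<Rightarrow>
     ('a \<Rightarrow> 'a^'n^'n) \<Rightarrow> ('a \<Rightarrow> 'a^'n^'n) \<Rightarrow> 'a set set" where
  "coker_nabla D \<sigma> \<sigma>bar \<sigma>hat = UNIV // nabla_rel D \<sigma> \<sigma>bar \<sigma>hat"

definition integral_map ::
    "('a::real_algebra_1 \<Rightarrow> 'a^'n::finite) \<Rightarrow> ('a \<Rightarrow> 'a^'n^'n) \<Rightarrow>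
     ('a \<Rightarrow> 'a^'n^'n) \<Rightarrow> ('a \<Rightarrow> 'a^'n^'n) \<Rightarrow> 'a \<Rightarrow> 'a set" where
  "integral_map D \<sigma> \<sigma>bar \<sigma>hat a = nabla_rel D \<sigma> \<sigma>bar \<sigma>hat `` {a}"

text \<open>
  Sum and scalar multiples of cosets are computed on representatives: each union below is
  over the cosets obtained from all choices of representatives.
\<close>

definition coker_iso ::
    "('a::real_algebra_1 \<Rightarrow> 'a^'n::finite) \<Rightarrow> ('a \<Rightarrow> 'a^'n^'n) \<Rightarrow>
     ('a \<Rightarrow> 'a^'n^'n) \<Rightarrow> ('a \<Rightarrow> 'a^'n^'n) \<Rightarrow> ('a set \<Rightarrow> 'b::real_vector) \<Rightarrow> bool" where
  "coker_iso D \<sigma> \<sigma>bar \<sigma>hat \<phi> \<longleftrightarrow>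
     (let C = coker_nabla D \<sigma> \<sigma>bar \<sigma>hat; \<Lambda> = integral_map D \<sigma> \<sigma>bar \<sigma>hat in
      bij_betw \<phi> C UNIV \<and>
      (\<forall>X\<in>C. \<forall>Y\<in>C. \<phi> (\<Union>x\<in>X. \<Union>y\<in>Y. \<Lambda> (x + y)) = \<phi> X + \<phi> Y) \<and>
      (\<forall>r. \<forall>X\<in>C. \<phi> (\<Union>x\<in>X. \<Lambda> (r *\<^sub>R x)) = r *\<^sub>R \<phi> X))"

section \<open>Functions on the circle\<close>

text \<open>
  A function on \<open>[0,1]\<close> is encoded as a function on the reals that vanishes outside \<open>[0,1]\<close>.
  The coinductive definition gives the largest set of functions \<open>f\<close> on \<open>[0,1]\<close> with
  \<open>f(0) = f(1)\<close> that is mapped into itself by differentiation (one-sided at the end points):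
  the functions all of whose derivatives exist and take equal values at 0 and 1, that is, the
  smooth functions on the circle. They are continuous, hence integrable, on \<open>[0,1]\<close>.
\<close>

coinductive_set circle_funs :: "(real \<Rightarrow> real) set" where
  "\<lbrakk>\<And>x. x \<notin> {0..1} \<Longrightarrow> f x = 0; f 0 = f 1; g \<in> circle_funs;
    \<And>x. x \<in> {0..1} \<Longrightarrow> (f has_real_derivative g x) (at x within {0..1})\<rbrakk>
   \<Longrightarrow> f \<in> circle_funs"

lemma circle_funs_step:
  assumes "f \<in> circle_funs"
  shows "(\<forall>x. x \<notin> {0..1} \<longrightarrow> f x = 0) \<and> f 0 = f 1 \<and>
    (\<exists>g\<in>circle_funs. \<forall>x\<in>{0..1}. (f has_real_derivative g x) (at x within {0..1}))"
  using assms by (rule circle_funs.cases) blast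

lemma circle_funs_coinduct_step:
  assumes "h \<in> X"
    and "\<And>f. f \<in> X \<Longrightarrow> (\<forall>x. x \<notin> {0..1} \<longrightarrow> f x = 0) \<and> f 0 = f 1 \<and>
      (\<exists>g\<in>X. \<forall>x\<in>{0..1}. (f has_real_derivative g x) (at x within {0..1}))"
  shows "h \<in> circle_funs"
proof (rule circle_funs.coinduct[where X="\<lambda>f. f \<in> X", OF assms(1)])
  fix f assume f: "f \<in> X"
  obtain g where "g \<in> X" "\<forall>x\<in>{0..1}. (f has_real_derivative g x) (at x within {0..1})"
    using assms(2)[OF f] by blast
  then show "\<exists>f' g. f = f' \<and> (\<forall>x. x \<notin> {0..1} \<longrightarrow> f' x = 0) \<and> f' 0 = f' 1 \<and>
      (g \<in> X \<or> g \<in> circle_funs) \<and>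
      (\<forall>x. x \<in> {0..1} \<longrightarrow> (f' has_real_derivative g x) (at x within {0..1}))"
    using assms(2)[OF f] by (intro exI[of _ f] exI[of _ g]) simp
qed

lemma circle_funs_zero: "(\<lambda>_. 0) \<in> circle_funs"
  by (rule circle_funs_coinduct_step[of _ "{\<lambda>_. 0}"]) auto

lemma circle_funs_const: "(\<lambda>x. if x \<in> {0..1} then c else 0) \<in> circle_funs"
proof (rule circle_funs.intros[OF _ _ circle_funs_zero])
  fix x :: real assume x: "x \<in> {0..1}"
  have "((\<lambda>_. c) has_real_derivative 0) (at x within {0..1})" by simp
  then show "((\<lambda>x. if x \<in> {0..1} then c else 0) has_real_derivative 0) (at x within {0..1})"
    by (rule has_field_derivative_transform_within[where d=1]) (use x in auto)
qed auto

lemma circle_funs_add: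
  assumes "f \<in> circle_funs" "g \<in> circle_funs"
  shows "(\<lambda>x. f x + g x) \<in> circle_funs"
proof (rule circle_funs_coinduct_step)
  show "(\<lambda>x. f x + g x) \<in> (\<Union>f\<in>circle_funs. \<Union>g\<in>circle_funs. {\<lambda>x. f x + g x})"
    using assms by blast
next
  fix h assume "h \<in> (\<Union>f\<in>circle_funs. \<Union>g\<in>circle_funs. {\<lambda>x. f x + g x})"
  then obtain f g where h: "h = (\<lambda>x. f x + g x)" and fg: "f \<in> circle_funs" "g \<in> circle_funs"
    by blast
  obtain f' g' where f': "f' \<in> circle_funs"
      "\<And>x. x \<in> {0..1} \<Longrightarrow> (f has_real_derivative f' x) (at x within {0..1})"
    and g': "g' \<in> circle_funs"
      "\<And>x. x \<in> {0..1} \<Longrightarrow> (g has_real_derivative g' x) (at x within {0..1})"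
    using fg[THEN circle_funs_step] by metis
  have "\<forall>x\<in>{0..1}. (h has_real_derivative f' x + g' x) (at x within {0..1})"
    unfolding h using f'(2) g'(2) by (blast intro: DERIV_add)
  moreover have "(\<lambda>x. f' x + g' x) \<in> (\<Union>f\<in>circle_funs. \<Union>g\<in>circle_funs. {\<lambda>x. f x + g x})"
    using f'(1) g'(1) by blast
  moreover have "(\<forall>x. x \<notin> {0..1} \<longrightarrow> h x = 0) \<and> h 0 = h 1"
    using fg[THEN circle_funs_step] by (simp add: h)
  ultimately show "(\<forall>x. x \<notin> {0..1} \<longrightarrow> h x = 0) \<and> h 0 = h 1 \<and>
      (\<exists>h'\<in>\<Union>f\<in>circle_funs. \<Union>g\<in>circle_funs. {\<lambda>x. f x + g x}.
        \<forall>x\<in>{0..1}. (h has_real_derivative h' x) (at x within {0..1}))"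
    by (blast intro: bexI[of _ "\<lambda>x. f' x + g' x"])
qed

text \<open>The sums of products of two functions form a set closed under differentiation.\<close>

inductive_set circle_prods :: "(real \<Rightarrow> real) set" where
  "f \<in> circle_funs \<Longrightarrow> g \<in> circle_funs \<Longrightarrow> (\<lambda>x. f x * g x) \<in> circle_prods"
| "f \<in> circle_prods \<Longrightarrow> g \<in> circle_prods \<Longrightarrow> (\<lambda>x. f x + g x) \<in> circle_prods"

lemma circle_prods_deriv:
  assumes "h \<in> circle_prods"
  shows "(\<forall>x. x \<notin> {0..1} \<longrightarrow> h x = 0) \<and> h 0 = h 1 \<and>
    (\<exists>h'\<in>circle_prods. \<forall>x\<in>{0..1}. (h has_real_derivative h' x) (at x within {0..1}))"
  using assms
proof (induction)
  case (1 f g)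
  obtain f' g' where f': "f' \<in> circle_funs"
      "\<And>x. x \<in> {0..1} \<Longrightarrow> (f has_real_derivative f' x) (at x within {0..1})"
    and g': "g' \<in> circle_funs"
      "\<And>x. x \<in> {0..1} \<Longrightarrow> (g has_real_derivative g' x) (at x within {0..1})"
    using 1[THEN circle_funs_step] by metis
  have "(\<lambda>x. f' x * g x + g' x * f x) \<in> circle_prods"
    by (intro circle_prods.intros 1 f' g')
  moreover have "((\<lambda>x. f x * g x) has_real_derivative f' x * g x + g' x * f x) (at x within {0..1})"
    if "x \<in> {0..1}" for x
    using f'(2)[OF that] g'(2)[OF that] by (rule DERIV_mult)
  ultimately have "\<exists>h'\<in>circle_prods. \<forall>x\<in>{0..1}.
      ((\<lambda>x. f x * g x) has_real_derivative h' x) (at x within {0..1})"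
    by (intro bexI[of _ "\<lambda>x. f' x * g x + g' x * f x"]) auto
  then show ?case using 1[THEN circle_funs_step] by simp
next
  case (2 f g)
  obtain f' where f': "f' \<in> circle_prods"
    "\<And>x. x \<in> {0..1} \<Longrightarrow> (f has_real_derivative f' x) (at x within {0..1})"
    using 2(3) by blast
  obtain g' where g': "g' \<in> circle_prods"
    "\<And>x. x \<in> {0..1} \<Longrightarrow> (g has_real_derivative g' x) (at x within {0..1})"
    using 2(4) by blast
  have "((\<lambda>x. f x + g x) has_real_derivative f' x + g' x) (at x within {0..1})"
    if "x \<in> {0..1}" for x
    using f'(2)[OF that] g'(2)[OF that] by (rule DERIV_add)
  then have "\<exists>h'\<in>circle_prods. \<forall>x\<in>{0..1}.
      ((\<lambda>x. f x + g x) has_real_derivative h' x) (at x within {0..1})"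
    by (intro bexI[of _ "\<lambda>x. f' x + g' x"] circle_prods.intros f' g') auto
  then show ?case using 2(3,4) by simp
qed

lemma circle_funs_mult:
  assumes "f \<in> circle_funs" "g \<in> circle_funs"
  shows "(\<lambda>x. f x * g x) \<in> circle_funs"
proof -
  have "(\<lambda>x. f x * g x) \<in> circle_prods"
    using assms by (rule circle_prods.intros)
  then show ?thesis
    by (rule circle_funs_coinduct_step) (rule circle_prods_deriv)
qed

lemma circle_funs_vanish: "f \<in> circle_funs \<Longrightarrow> x \<notin> {0..1} \<Longrightarrow> f x = 0"
  using circle_funs_step by blast

lemma circle_funs_scale:
  assumes "f \<in> circle_funs"
  shows "(\<lambda>x. c * f x) \<in> circle_funs"
proof -
  have "(\<lambda>x. c * f x) = (\<lambda>x. (if x \<in> {0..1} then c else 0) * f x)"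
    using circle_funs_vanish[OF assms] by force
  then show ?thesis using circle_funs_mult[OF circle_funs_const[of c] assms] by simp
qed

lemma circle_funs_deriv:
  assumes "f \<in> circle_funs"
  shows "(\<lambda>x. if x \<in> {0..1} then vector_derivative f (at x within {0..1}) else 0) \<in> circle_funs"
proof -
  obtain g where g: "g \<in> circle_funs"
    "\<And>x. x \<in> {0..1} \<Longrightarrow> (f has_real_derivative g x) (at x within {0..1})"
    using circle_funs_step[OF assms] by blast
  have "vector_derivative f (at x within {0..1}) = g x" if "x \<in> {0..1}" for x
    using g(2)[OF that] that
    by (intro vector_derivative_within_cbox[of 0 1, simplified])
      (auto simp: has_real_derivative_iff_has_vector_derivative)
  then have "(\<lambda>x. if x \<in> {0..1} then vector_derivative f (at x within {0..1}) else 0) = g"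
    using circle_funs_vanish[OF g(1)] by auto
  then show ?thesis using g(1) by simp
qed

typedef circle_fun = circle_funs
  morphisms circle_eval Abs_circle_fun
  using circle_funs_zero by blast

setup_lifting type_definition_circle_fun

instantiation circle_fun :: real_algebra_1
begin

lift_definition zero_circle_fun :: circle_fun is "\<lambda>_. 0"
  by (rule circle_funs_zero)

lift_definition one_circle_fun :: circle_fun is "\<lambda>x. if x \<in> {0..1} then 1 else 0"
  by (rule circle_funs_const)

lift_definition plus_circle_fun :: "circle_fun \<Rightarrow> circle_fun \<Rightarrow> circle_fun"
  is "\<lambda>f g x. f x + g x"
  by (rule circle_funs_add)

lift_definition times_circle_fun :: "circle_fun \<Rightarrow> circle_fun \<Rightarrow> circle_fun"
  is "\<lambda>f g x. f x * g x"
  by (rule circle_funs_mult)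

lift_definition scaleR_circle_fun :: "real \<Rightarrow> circle_fun \<Rightarrow> circle_fun"
  is "\<lambda>c f x. c * f x"
  by (rule circle_funs_scale)

lift_definition uminus_circle_fun :: "circle_fun \<Rightarrow> circle_fun" is "\<lambda>f x. - f x"
  using circle_funs_scale[of _ "-1"] by simp

definition minus_circle_fun :: "circle_fun \<Rightarrow> circle_fun \<Rightarrow> circle_fun" where
  "f - g = f + - g" for f g :: circle_fun

instance
proof
  show "(0::circle_fun) \<noteq> 1"
    by transfer (auto simp: fun_eq_iff intro!: exI[of _ 0])
  show "1 * a = a" and "a * 1 = a" for a :: circle_fun
    by (transfer, use circle_funs_vanish in force)+
qed (unfold minus_circle_fun_def, (transfer, simp add: fun_eq_iff algebra_simps)+)

end

lift_definition circle_deriv :: "circle_fun \<Rightarrow> circle_fun"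
  is "\<lambda>f x. if x \<in> {0..1} then vector_derivative f (at x within {0..1}) else 0"
  by (rule circle_funs_deriv)

section \<open>The supercircle\<close>

text \<open>\<open>Grassmann a0 a1\<close> is \<open>a0 + a1 \<theta>\<close>, where \<open>\<theta>\<close> commutes with the coefficients and \<open>\<theta>\<^sup>2 = 0\<close>.\<close>

datatype 'a grassmann = Grassmann (coeff0: 'a) (coeff1: 'a)

instantiation grassmann :: (real_algebra_1) real_algebra_1
begin

definition "0 = Grassmann 0 0"
definition "1 = Grassmann 1 0"
definition "a + b = Grassmann (coeff0 a + coeff0 b) (coeff1 a + coeff1 b)"
definition "a - b = Grassmann (coeff0 a - coeff0 b) (coeff1 a - coeff1 b)"
definition "- a = Grassmann (- coeff0 a) (- coeff1 a)"
definition "a * b = Grassmann (coeff0 a * coeff0 b) (coeff0 a * coeff1 b + coeff1 a * coeff0 b)"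
definition "r *\<^sub>R a = Grassmann (r *\<^sub>R coeff0 a) (r *\<^sub>R coeff1 a)"

instance
  by standard
    (auto simp: zero_grassmann_def one_grassmann_def plus_grassmann_def minus_grassmann_def
      uminus_grassmann_def times_grassmann_def scaleR_grassmann_def algebra_simps)

end

type_synonym supercircle = "circle_fun grassmann"

definition partial_x :: "supercircle \<Rightarrow> supercircle" where
  "partial_x a = Grassmann (circle_deriv (coeff0 a)) (circle_deriv (coeff1 a))"

definition partial_theta :: "supercircle \<Rightarrow> supercircle" where
  "partial_theta a = Grassmann (coeff1 a) 0"

definition sigma_xx :: "supercircle \<Rightarrow> supercircle" where
  "sigma_xx a = a"

definition sigma_theta_theta :: "supercircle \<Rightarrow> supercircle" where
  "sigma_theta_theta a = Grassmann (coeff0 a) (- coeff1 a)"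

text \<open>The elements 1 and 2 of the index type \<open>2\<close> play the roles of \<open>x\<close> and \<open>\<theta>\<close>.\<close>

definition super_partial :: "supercircle \<Rightarrow> supercircle^2" where
  "super_partial a = vector [partial_x a, partial_theta a]"

definition super_sigma :: "supercircle \<Rightarrow> supercircle^2^2" where
  "super_sigma a = vector [vector [sigma_xx a, 0], vector [0, sigma_theta_theta a]]"

end

theory Submission
  imports Defs
begin

text \<open>
  A right module map \<open>f\<close> on the one-forms is determined by \<open>p = f(dx)\<close> and \<open>q = f(d\<theta>)\<close>, and
  these two values can be prescribed freely: since \<open>\<sigma>\<^sub>x\<^sub>x\<close> and \<open>\<sigma>\<^sub>\<theta>\<^sub>\<theta>\<close> are involutive algebra maps,
  \<open>f(u dx + v d\<theta>) = p u + q \<sigma>\<^sub>\<theta>\<^sub>\<theta>(v)\<close>. Hence the image of \<open>\<nabla>\<close> consists of all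
  \<open>\<partial>\<^sub>x p + \<sigma>\<^sub>\<theta>\<^sub>\<theta>(\<partial>\<^sub>\<theta>(\<sigma>\<^sub>\<theta>\<^sub>\<theta> q)) = (dp\<^sup>0/dx - q\<^sup>1) + (dp\<^sup>1/dx) \<theta>\<close>. The term \<open>q\<^sup>1\<close> makes the coefficient of 1
  arbitrary, while the coefficient of \<open>\<theta>\<close> ranges over the derivatives of functions on the circle.
  By the fundamental theorem of calculus, a function on the circle is such a derivative exactly
  when its integral over a period vanishes: that is the condition for the antiderivative
  \<open>x \<mapsto> \<integral>\<^sub>0\<^sup>x h\<close> to be periodic (\<open>range_circle_deriv\<close>).

  So the image of \<open>\<nabla>\<close> is the kernel of the Berezin functional \<open>a \<mapsto> \<integral>\<^sub>0\<^sup>1 a\<^sup>1\<close>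
  (\<open>image_nabla_super\<close>). This functional is linear and onto the reals, so it induces an isomorphism
  from the cokernel of \<open>\<nabla>\<close> to the reals (\<open>coker_iso_from_functional\<close>), and under this
  isomorphism the projection onto the cokernel becomes the functional itself.
\<close>

section \<open>Differentiation and integration on the circle\<close>

lemma circle_eval_add: "circle_eval (f + g) x = circle_eval f x + circle_eval g x"
  by transfer simp

lemma circle_eval_scaleR: "circle_eval (c *\<^sub>R f) x = c * circle_eval f x"
  by transfer simp

lemma circle_eval_mult: "circle_eval (f * g) x = circle_eval f x * circle_eval g x"
  by transfer simp

lemma circle_eval_one: "x \<in> {0..1} \<Longrightarrow> circle_eval 1 x = 1"
  by transfer simp

lemma circle_eval_ends: "circle_eval f 0 = circle_eval f 1"
  using circle_funs_step[OF circle_eval[of f]] by blast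

lemma circle_fun_eqI:
  assumes "\<And>x. x \<in> {0..1} \<Longrightarrow> circle_eval f x = circle_eval g x"
  shows "f = g"
proof -
  have "circle_eval f x = circle_eval g x" for x
    using assms[of x] circle_funs_vanish[OF circle_eval, of x] by (cases "x \<in> {0..1}") auto
  then show ?thesis by (simp add: circle_eval_inject[symmetric] fun_eq_iff)
qed

instance circle_fun :: comm_ring
proof
  fix f g h :: circle_fun
  show "f * g = g * f"
    by (rule circle_fun_eqI) (simp add: circle_eval_mult)
  show "(f + g) * h = f * h + g * h"
    by (rule distrib_right)
qed

lemma vector_derivative_unit_interval:
  fixes f :: "real \<Rightarrow> real"
  assumes "(f has_real_derivative d) (at x within {0..1})" "x \<in> {0..1}"
  shows "vector_derivative f (at x within {0..1}) = d"
  using assms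
  by (intro vector_derivative_within_cbox[of 0 1, simplified])
    (auto simp: has_real_derivative_iff_has_vector_derivative)

lemma circle_deriv_eval:
  assumes "x \<in> {0..1}"
  shows "(circle_eval f has_real_derivative circle_eval (circle_deriv f) x) (at x within {0..1})"
proof -
  obtain g where g: "(circle_eval f has_real_derivative g) (at x within {0..1})"
    using circle_funs_step[OF circle_eval[of f]] assms by blast
  have "circle_eval (circle_deriv f) x = g"
    using assms vector_derivative_unit_interval[OF g] by transfer simp
  with g show ?thesis by simp
qed

lemma circle_deriv_eqI:
  assumes "\<And>x. x \<in> {0..1} \<Longrightarrow>
    (circle_eval f has_real_derivative circle_eval g x) (at x within {0..1})"
  shows "circle_deriv f = g"
proof (rule circle_fun_eqI)
  fix x :: real assume x: "x \<in> {0..1}"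
  show "circle_eval (circle_deriv f) x = circle_eval g x"
    using vector_derivative_unit_interval[OF circle_deriv_eval[OF x] x]
      vector_derivative_unit_interval[OF assms[OF x] x] by simp
qed

lemma circle_deriv_add: "circle_deriv (f + g) = circle_deriv f + circle_deriv g"
proof (rule circle_deriv_eqI)
  fix x :: real assume "x \<in> {0..1}"
  then show "(circle_eval (f + g) has_real_derivative
      circle_eval (circle_deriv f + circle_deriv g) x) (at x within {0..1})"
    unfolding circle_eval_add by (intro DERIV_add circle_deriv_eval)
qed

lemma circle_deriv_scaleR: "circle_deriv (c *\<^sub>R f) = c *\<^sub>R circle_deriv f"
proof (rule circle_deriv_eqI)
  fix x :: real assume "x \<in> {0..1}"
  then show "(circle_eval (c *\<^sub>R f) has_real_derivative circle_eval (c *\<^sub>R circle_deriv f) x)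
      (at x within {0..1})"
    unfolding circle_eval_scaleR by (intro DERIV_cmult circle_deriv_eval)
qed

lemma circle_deriv_zero [simp]: "circle_deriv 0 = 0"
  using circle_deriv_scaleR[of 0 0] by simp

lemma circle_deriv_mult: "circle_deriv (f * g) = circle_deriv f * g + f * circle_deriv g"
proof (rule circle_deriv_eqI)
  fix x :: real assume x: "x \<in> {0..1}"
  show "(circle_eval (f * g) has_real_derivative
      circle_eval (circle_deriv f * g + f * circle_deriv g) x) (at x within {0..1})"
    unfolding circle_eval_add circle_eval_mult
    using DERIV_mult[OF circle_deriv_eval[OF x, of f] circle_deriv_eval[OF x, of g]]
    by (simp add: mult.commute)
qed

lemma continuous_on_circle_eval: "continuous_on {0..1} (circle_eval f)"
  by (rule DERIV_continuous_on[OF circle_deriv_eval])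

lemma circle_eval_integrable: "circle_eval f integrable_on {0..1}"
  by (rule integrable_continuous_real[OF continuous_on_circle_eval])

definition circle_integral :: "circle_fun \<Rightarrow> real" where
  "circle_integral f = integral {0..1} (circle_eval f)"

lemma linear_circle_integral: "linear circle_integral"
  by (rule linearI)
    (simp_all add: circle_integral_def circle_eval_add[abs_def] circle_eval_scaleR[abs_def]
      integral_add circle_eval_integrable)

lemma circle_integral_one: "circle_integral 1 = 1"
proof -
  have "integral {0..1} (circle_eval 1) = integral {0..1} (\<lambda>_ :: real. 1 :: real)"
    by (rule integral_cong) (rule circle_eval_one)
  then show ?thesis by (simp add: circle_integral_def)
qed

lemma circle_integral_deriv: "circle_integral (circle_deriv f) = 0"
proof -
  have "(circle_eval (circle_deriv f) has_integral circle_eval f 1 - circle_eval f 0) {0..1}"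
    by (rule fundamental_theorem_of_calculus)
      (auto simp flip: has_real_derivative_iff_has_vector_derivative intro: circle_deriv_eval)
  then show ?thesis by (simp add: circle_integral_def circle_eval_ends integral_unique)
qed

lemma circle_antiderivative:
  assumes "circle_integral h = 0"
  obtains H where "circle_deriv H = h"
proof -
  define F where "F x = (if x \<in> {0..1} then integral {0..x} (circle_eval h) else 0)" for x :: real
  have deriv: "(F has_real_derivative circle_eval h x) (at x within {0..1})"
    if x: "x \<in> {0..1}" for x
  proof (rule has_field_derivative_transform_within[where d=1])
    show "((\<lambda>u. integral {0..u} (circle_eval h)) has_real_derivative circle_eval h x)
        (at x within {0..1})"
      using continuous_on_circle_eval x by (rule integral_has_real_derivative)
  qed (use x in \<open>auto simp: F_def\<close>)
  \<comment> \<open>The vanishing of the integral is the periodicity \<open>F(0) = F(1)\<close>.\<close>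
  have "F \<in> circle_funs"
    by (rule circle_funs.intros[OF _ _ circle_eval[of h] deriv])
      (use assms in \<open>auto simp: F_def circle_integral_def\<close>)
  then have "circle_eval (Abs_circle_fun F) = F"
    by (rule Abs_circle_fun_inverse)
  then have "circle_deriv (Abs_circle_fun F) = h"
    using deriv by (intro circle_deriv_eqI) simp
  then show thesis by (rule that)
qed

text \<open>
  The first de Rham cohomology of the circle: a function has a periodic antiderivative if and only
  if its integral over a period vanishes.
\<close>

lemma range_circle_deriv: "range circle_deriv = {h. circle_integral h = 0}"
proof (intro equalityI subsetI)
  fix h assume "h \<in> {h. circle_integral h = 0}"
  then have "circle_integral h = 0" by simp
  then obtain H where "circle_deriv H = h" by (rule circle_antiderivative)
  then show "h \<in> range circle_deriv" by blast
qed (auto simp: circle_integral_deriv)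

section \<open>The twisted multi-derivation on the supercircle\<close>

lemma coeff_zero [simp]: "coeff0 0 = 0" "coeff1 0 = 0"
  by (simp_all add: zero_grassmann_def)

lemma coeff_one [simp]: "coeff0 1 = 1" "coeff1 1 = 0"
  by (simp_all add: one_grassmann_def)

lemma coeff_add [simp]:
  "coeff0 (a + b) = coeff0 a + coeff0 b" "coeff1 (a + b) = coeff1 a + coeff1 b"
  by (simp_all add: plus_grassmann_def)

lemma coeff_mult [simp]:
  "coeff0 (a * b) = coeff0 a * coeff0 b"
  "coeff1 (a * b) = coeff0 a * coeff1 b + coeff1 a * coeff0 b"
  by (simp_all add: times_grassmann_def)

lemma coeff_scaleR [simp]: "coeff0 (r *\<^sub>R a) = r *\<^sub>R coeff0 a" "coeff1 (r *\<^sub>R a) = r *\<^sub>R coeff1 a"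
  by (simp_all add: scaleR_grassmann_def)

lemma coeff_partial_x [simp]:
  "coeff0 (partial_x a) = circle_deriv (coeff0 a)"
  "coeff1 (partial_x a) = circle_deriv (coeff1 a)"
  by (simp_all add: partial_x_def)

lemma coeff_partial_theta [simp]:
  "coeff0 (partial_theta a) = coeff1 a" "coeff1 (partial_theta a) = 0"
  by (simp_all add: partial_theta_def)

lemma coeff_sigma_theta_theta [simp]:
  "coeff0 (sigma_theta_theta a) = coeff0 a" "coeff1 (sigma_theta_theta a) = - coeff1 a"
  by (simp_all add: sigma_theta_theta_def)

lemma super_partial_nth [simp]:
  "super_partial a $ 1 = partial_x a" "super_partial a $ 2 = partial_theta a"
  by (simp_all add: super_partial_def)

lemma super_sigma_nth [simp]:
  "super_sigma a $ 1 $ 1 = a" "super_sigma a $ 1 $ 2 = 0"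
  "super_sigma a $ 2 $ 1 = 0" "super_sigma a $ 2 $ 2 = sigma_theta_theta a"
  by (simp_all add: super_sigma_def sigma_xx_def)

lemma sigma_theta_theta_involutive [simp]: "sigma_theta_theta (sigma_theta_theta a) = a"
  by (simp add: grassmann.expand)

lemma sigma_theta_theta_hom [simp]:
  "sigma_theta_theta 0 = 0" "sigma_theta_theta 1 = 1"
  "sigma_theta_theta (a + b) = sigma_theta_theta a + sigma_theta_theta b"
  "sigma_theta_theta (a * b) = sigma_theta_theta a * sigma_theta_theta b"
  "sigma_theta_theta (r *\<^sub>R a) = r *\<^sub>R sigma_theta_theta a"
  by (simp_all add: grassmann.expand)

lemma linear_super_partial: "linear super_partial"
  by (rule linearI)
    (simp_all add: vec_eq_iff forall_2 grassmann.expand circle_deriv_add circle_deriv_scaleR)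

lemma algebra_map_super_sigma: "algebra_map super_sigma"
  unfolding algebra_map_def
  by (auto intro!: linearI simp: vec_eq_iff forall_2 mat_def matrix_matrix_mult_def sum_2)

text \<open>
  The \<open>\<theta>\<close>-component of the twisted Leibniz rule is where the sign in \<open>\<sigma>\<^sub>\<theta>\<^sub>\<theta>\<close> is needed: in
  \<open>\<partial>\<^sub>\<theta>(a) \<sigma>\<^sub>\<theta>\<^sub>\<theta>(b) + a \<partial>\<^sub>\<theta>(b)\<close> the two terms \<open>\<plusminus> a\<^sup>1 b\<^sup>1 \<theta>\<close> cancel.
\<close>

lemma super_partial_twisted:
  "right_twisted_multi_derivation super_partial super_sigma"
  using linear_super_partial algebra_map_super_sigma
  by (simp add: right_twisted_multi_derivation_def algebra_map_def forall_2 sum_2 grassmann.expand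
      circle_deriv_mult circle_deriv_add algebra_simps)

lemma super_partial_free:
  "free_right_twisted_multi_derivation super_partial super_sigma super_sigma super_sigma"
  unfolding free_right_twisted_multi_derivation_def forall_2 sum_2
  using super_partial_twisted algebra_map_super_sigma by (simp add: algebra_map_def)

section \<open>The image of the hom-connection\<close>

lemma nabla_super:
  "nabla super_partial super_sigma super_sigma f =
     Grassmann (circle_deriv (coeff0 (f (axis 1 1))) - coeff1 (f (axis 2 1)))
       (circle_deriv (coeff1 (f (axis 1 1))))"
proof -
  have [simp]: "super_partial 0 = 0"
    using linear_0[OF linear_super_partial] .
  show ?thesis
    by (simp add: nabla_def partial_sigma_def sum_2 grassmann.expand)
qed

text \<open>
  The values on the basis forms are arbitrary. For a form \<open>v d\<theta>\<close> the coefficient is on the left, and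
  \<open>v d\<theta> = d\<theta> \<cdot> \<sigma>\<^sub>\<theta>\<^sub>\<theta>(v)\<close>, so right linearity forces the twist in the second term.
\<close>

lemma form_hom_with_values:
  obtains f where "f \<in> form_hom super_sigma" "f (axis 1 1) = p" "f (axis 2 1) = q"
proof
  let ?f = "\<lambda>w :: supercircle^2. p * w $ 1 + q * sigma_theta_theta (w $ 2)"
  show "?f \<in> form_hom super_sigma"
    by (simp add: form_hom_def form_right_act_def sum_2 algebra_simps)
  show "?f (axis 1 1) = p" "?f (axis 2 1) = q"
    by (simp_all add: axis_def)
qed

lemma image_nabla_super:
  "nabla super_partial super_sigma super_sigma ` form_hom super_sigma =
     {c. circle_integral (coeff1 c) = 0}"
proof (intro equalityI subsetI)
  fix c assume "c \<in> {c. circle_integral (coeff1 c) = 0}"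
  then have "coeff1 c \<in> range circle_deriv"
    by (simp add: range_circle_deriv)
  then obtain H where H: "circle_deriv H = coeff1 c"
    by auto
  \<comment> \<open>\<open>\<partial>\<^sub>x\<close> of \<open>H \<theta>\<close> gives the coefficient of \<open>\<theta>\<close>; \<open>- c\<^sup>0 \<theta>\<close> as the value on \<open>d\<theta>\<close> gives \<open>c\<^sup>0\<close>.\<close>
  obtain f where "f \<in> form_hom super_sigma"
      "f (axis 1 1) = Grassmann 0 H" "f (axis 2 1) = Grassmann 0 (- coeff0 c)"
    by (rule form_hom_with_values)
  moreover from this have "nabla super_partial super_sigma super_sigma f = c"
    by (simp add: nabla_super H)
  ultimately show "c \<in> nabla super_partial super_sigma super_sigma ` form_hom super_sigma"
    by blast
qed (auto simp: nabla_super circle_integral_deriv)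

section \<open>The cokernel\<close>

text \<open>
  The first isomorphism theorem: a functional \<open>L\<close> is constant on each coset of its kernel, so the
  induced map sends a coset \<open>X\<close> to the only element of \<open>L ` X\<close>.
\<close>

lemma coker_iso_from_functional:
  fixes L :: "'a::real_algebra_1 \<Rightarrow> 'b::real_vector"
  assumes L: "linear L" "surj L"
    and kernel: "nabla D \<sigma>bar \<sigma>hat ` form_hom \<sigma> = {c. L c = 0}"
  obtains \<phi> where "coker_iso D \<sigma> \<sigma>bar \<sigma>hat \<phi>"
    and "\<And>a. \<phi> (integral_map D \<sigma> \<sigma>bar \<sigma>hat a) = L a"
proof
  let ?\<phi> = "\<lambda>X. the_elem (L ` X)" and ?\<Lambda> = "integral_map D \<sigma> \<sigma>bar \<sigma>hat"
    and ?C = "coker_nabla D \<sigma> \<sigma>bar \<sigma>hat"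
  have coset: "?\<Lambda> a = {b. L b = L a}" for a
    by (auto simp: integral_map_def nabla_rel_def kernel linear_diff[OF L(1)])
  have C: "?C = range ?\<Lambda>"
    by (auto simp: coker_nabla_def quotient_def integral_map_def)
  have "L ` ?\<Lambda> a = {L a}" for a
    by (auto simp: coset)
  then show induced: "?\<phi> (?\<Lambda> a) = L a" for a
    by simp
  have "bij_betw ?\<phi> ?C UNIV"
    unfolding bij_betw_def
  proof
    show "inj_on ?\<phi> ?C"
      unfolding C by (auto intro!: inj_onI simp: induced) (auto simp: coset)
    show "?\<phi> ` ?C = UNIV"
      using L(2) by (simp add: C image_image induced)
  qed
  moreover have "(\<Union>x\<in>?\<Lambda> a. \<Union>y\<in>?\<Lambda> b. ?\<Lambda> (x + y)) = ?\<Lambda> (a + b)" for a b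
    by (auto simp: coset linear_add[OF L(1)])
  moreover have "(\<Union>x\<in>?\<Lambda> a. ?\<Lambda> (r *\<^sub>R x)) = ?\<Lambda> (r *\<^sub>R a)" for r a
    by (auto simp: coset linear_scale[OF L(1)])
  ultimately show "coker_iso D \<sigma> \<sigma>bar \<sigma>hat ?\<phi>"
    by (simp add: coker_iso_def C induced linear_add[OF L(1)] linear_scale[OF L(1)])
qed

lemma linear_berezin: "linear (\<lambda>a :: supercircle. circle_integral (coeff1 a))"
  by (rule linearI)
    (simp_all add: linear_add[OF linear_circle_integral] linear_scale[OF linear_circle_integral])

lemma surj_berezin: "surj (\<lambda>a :: supercircle. circle_integral (coeff1 a))"
proof (rule surjI)
  show "circle_integral (coeff1 (Grassmann 0 (r *\<^sub>R 1))) = r" for r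
    by (simp add: linear_scale[OF linear_circle_integral] circle_integral_one)
qed

theorem lemma3p5:
  "free_right_twisted_multi_derivation super_partial super_sigma super_sigma super_sigma \<and>
   (\<exists>\<phi> :: supercircle set \<Rightarrow> real.
      coker_iso super_partial super_sigma super_sigma super_sigma \<phi> \<and>
      (\<forall>a. \<phi> (integral_map super_partial super_sigma super_sigma super_sigma a) =
             integral {0..1} (circle_eval (coeff1 a))))"
proof
  show "\<exists>\<phi> :: supercircle set \<Rightarrow> real.
      coker_iso super_partial super_sigma super_sigma super_sigma \<phi> \<and>
      (\<forall>a. \<phi> (integral_map super_partial super_sigma super_sigma super_sigma a) =
             integral {0..1} (circle_eval (coeff1 a)))"
    using coker_iso_from_functional[OF linear_berezin surj_berezin image_nabla_super]
    unfolding circle_integral_def by metis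
qed (rule super_partial_free)

end
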